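(* Let $k=\mathbb{Q}$ and let $\Theta$ be the variety of all linear algebras over $k$. Let $H$ be the free algebra on two generators in the subvariety of $\Theta$ defined by the identity $(x_1x_1)x_2=0$. Let $a,b\in k$ with $a\neq\pm b$ and $b\neq 0$, and let $H_W^{*}$ be the linear algebra with the same underlying set, zero, negation, addition and multiplication by scalars as $H$, and with the new multiplication $u\times v=a\,uv+b\,vu$. Then the algebras $H$ and $H_W^{*}$ are not geometrically equivalent.
   Context: A linear algebra over $k$ is a $k$-vector space with a $k$-bilinear multiplication (no associativity, commutativity or unit is assumed). $\Theta$ is the variety of all linear algebras over $k$. For a finite subset $X$ of a countable set of symbols $X_0=\{x_1,x_2,\ldots\}$, $F(X)$ denotes the free algebra of $\Theta$ freely generated by $X$. For an algebra $H\in\Theta$, a finite $X\subset X_0$ and $T\subset F(X)\times F(X)$, put $T'_H=\{\mu\in\mathrm{Hom}(F(X),H)\mid T\subset\ker\mu\}$, where $\ker\mu$ is the kernel congruence $\{(f,g)\mid\mu(f)=\mu(g)\}$, and let $T''_H=\bigcap_{\mu\in T'_H}\ker\mu$ be the $H$-closure of $T$. Algebras $H_1,H_2\in\Theta$ are geometrically equivalent if $T''_{H_1}=T''_{H_2}$ for every finite $X\subset X_0$ and every $T\subset F(X)\times F(X)$. The notation $H_W^*$: it is the algebra whose operations are the verbal operations on $H$ given by the words $w_0=0$, $w_\lambda=\lambda x_1$ ($\lambda\in\mathbb{Q}$), $w_-=-x_1$, $w_+=x_1+x_2$, $w_\cdot=a x_1x_2+b x_2x_1$ (the field $\mathbb{Q}$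 has no nontrivial automorphisms). *)

theory Defs
  imports
    Complex_Main
    "HOL-Algebra.Module"
    "HOL-Algebra.QuotRing"
    "HOL-Library.Poly_Mapping"
begin

section \<open>Linear algebras\<close>

definition scalars :: "'k::field ring" where
  "scalars = \<lparr>carrier = UNIV, mult = (*), one = 1, zero = 0, add = (+)\<rparr>"

text \<open>
  Linear algebras are carried by the record type \<^type>\<open>module_ext\<close> of HOL-Algebra.
  Its field \<^const>\<open>one\<close> is meaningless here, since no unit is assumed; its value is never used.
\<close>

locale linear_algebra = module scalars A for A :: "('k::field, 'a) module" (structure) +
  assumes prod_closed: "x \<in> carrier A \<Longrightarrow> y \<in> carrier A \<Longrightarrow> x \<otimes> y \<in> carrier A"
    and prod_l_distr: "x \<in> carrier A \<Longrightarrow> y \<in> carrier A \<Longrightarrow> z \<in> carrier A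
          \<Longrightarrow> (x \<oplus> y) \<otimes> z = x \<otimes> z \<oplus> y \<otimes> z"
    and prod_r_distr: "x \<in> carrier A \<Longrightarrow> y \<in> carrier A \<Longrightarrow> z \<in> carrier A
          \<Longrightarrow> z \<otimes> (x \<oplus> y) = z \<otimes> x \<oplus> z \<otimes> y"
    and prod_smult_l: "x \<in> carrier A \<Longrightarrow> y \<in> carrier A \<Longrightarrow> (c \<odot> x) \<otimes> y = c \<odot> (x \<otimes> y)"
    and prod_smult_r: "x \<in> carrier A \<Longrightarrow> y \<in> carrier A \<Longrightarrow> x \<otimes> (c \<odot> y) = c \<odot> (x \<otimes> y)"

text \<open>Values of a homomorphism outside the carrier are irrelevant and left unconstrained.\<close>

definition alg_hom :: "('k::field, 'a) module \<Rightarrow> ('k, 'b) module \<Rightarrow> ('a \<Rightarrow> 'b) set" where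
  "alg_hom A B = {\<mu> \<in> carrier A \<rightarrow> carrier B.
     (\<forall>x\<in>carrier A. \<forall>y\<in>carrier A. \<mu> (x \<oplus>\<^bsub>A\<^esub> y) = \<mu> x \<oplus>\<^bsub>B\<^esub> \<mu> y) \<and>
     (\<forall>c. \<forall>x\<in>carrier A. \<mu> (c \<odot>\<^bsub>A\<^esub> x) = c \<odot>\<^bsub>B\<^esub> \<mu> x) \<and>
     (\<forall>x\<in>carrier A. \<forall>y\<in>carrier A. \<mu> (x \<otimes>\<^bsub>A\<^esub> y) = \<mu> x \<otimes>\<^bsub>B\<^esub> \<mu> y)}"

definition alg_ideal :: "'a set \<Rightarrow> ('k::field, 'a) module \<Rightarrow> bool" where
  "alg_ideal J A \<longleftrightarrow> submodule J scalars A \<and>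
     (\<forall>x\<in>carrier A. \<forall>y\<in>J. x \<otimes>\<^bsub>A\<^esub> y \<in> J \<and> y \<otimes>\<^bsub>A\<^esub> x \<in> J)"

definition alg_quot :: "('k::field, 'a) module \<Rightarrow> 'a set \<Rightarrow> ('k, 'a set) module" where
  "alg_quot A J = \<lparr>carrier = a_rcosets\<^bsub>A\<^esub> J, mult = rcoset_mult A J, one = undefined,
     zero = J, add = set_add A, smult = (\<lambda>c U. \<Union>u\<in>U. J +>\<^bsub>A\<^esub> (c \<odot>\<^bsub>A\<^esub> u))\<rparr>"


section \<open>Free algebras\<close>

text \<open>
  The symbol \<open>x\<^sub>i\<close> is represented by its index, so a set of symbols is a \<^typ>\<open>nat set\<close>.  The
  elements of \<open>F(X)\<close> are the nonassociative polynomials, that is the finitely supported linear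
  combinations of nonassociative words (elements of the free magma) in the symbols from \<open>X\<close>.
\<close>

datatype word = Sym nat | Prod word word

primrec symbols :: "word \<Rightarrow> nat set" where
  "symbols (Sym i) = {i}"
| "symbols (Prod s t) = symbols s \<union> symbols t"

definition poly_prod :: "(word \<Rightarrow>\<^sub>0 'k::field) \<Rightarrow> (word \<Rightarrow>\<^sub>0 'k) \<Rightarrow> (word \<Rightarrow>\<^sub>0 'k)" where
  "poly_prod p q = (\<Sum>s\<in>Poly_Mapping.keys p. \<Sum>t\<in>Poly_Mapping.keys q.
     Poly_Mapping.single (Prod s t) (Poly_Mapping.lookup p s * Poly_Mapping.lookup q t))"

definition free_alg :: "nat set \<Rightarrow> ('k::field, word \<Rightarrow>\<^sub>0 'k) module" where
  "free_alg X = \<lparr>carrier = {p. \<forall>t\<in>Poly_Mapping.keys p. symbols t \<subseteq> X}, mult = poly_prod,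
     one = undefined, zero = 0, add = (+), smult = (\<lambda>c. Poly_Mapping.map ((*) c))\<rparr>"

definition var :: "nat \<Rightarrow> (word \<Rightarrow>\<^sub>0 'k::field)" where
  "var i = Poly_Mapping.single (Sym i) 1"


section \<open>Relatively free algebras\<close>

text \<open>
  An identity \<open>p = 0\<close> is given by the polynomial \<open>p\<close>.  The free algebra on \<open>X\<close> of the subvariety
  defined by the identities \<open>p = 0\<close>, \<open>p \<in> E\<close>, is the quotient of \<open>F(X)\<close> by the verbal ideal of \<open>E\<close>;
  its defining universal property is \<open>rel_free_universal\<close> below.
\<close>

definition satisfies :: "('k::field, 'a) module \<Rightarrow> (word \<Rightarrow>\<^sub>0 'k) \<Rightarrow> bool" where
  "satisfies A p \<longleftrightarrow> (\<forall>\<mu>\<in>alg_hom (free_alg UNIV) A. \<mu> p = \<zero>\<^bsub>A\<^esub>)"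

definition verbal_ideal :: "(word \<Rightarrow>\<^sub>0 'k::field) set \<Rightarrow> nat set \<Rightarrow> (word \<Rightarrow>\<^sub>0 'k) set" where
  "verbal_ideal E X = \<Inter>{J. alg_ideal J (free_alg X) \<and>
     (\<forall>\<phi>\<in>alg_hom (free_alg UNIV) (free_alg X). \<phi> ` E \<subseteq> J)}"

definition rel_free :: "(word \<Rightarrow>\<^sub>0 'k::field) set \<Rightarrow> nat set \<Rightarrow> ('k, (word \<Rightarrow>\<^sub>0 'k) set) module" where
  "rel_free E X = alg_quot (free_alg X) (verbal_ideal E X)"

definition rel_gen :: "(word \<Rightarrow>\<^sub>0 'k::field) set \<Rightarrow> nat set \<Rightarrow> nat \<Rightarrow> (word \<Rightarrow>\<^sub>0 'k) set" where
  "rel_gen E X i = verbal_ideal E X +>\<^bsub>free_alg X\<^esub> var i"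


section \<open>Geometric equivalence\<close>

definition ker_cong :: "nat set \<Rightarrow> ((word \<Rightarrow>\<^sub>0 'k::field) \<Rightarrow> 'a)
    \<Rightarrow> ((word \<Rightarrow>\<^sub>0 'k) \<times> (word \<Rightarrow>\<^sub>0 'k)) set" where
  "ker_cong X \<mu> = {(f, g). f \<in> carrier (free_alg X) \<and> g \<in> carrier (free_alg X) \<and> \<mu> f = \<mu> g}"

definition solutions :: "('k::field, 'a) module \<Rightarrow> nat set
    \<Rightarrow> ((word \<Rightarrow>\<^sub>0 'k) \<times> (word \<Rightarrow>\<^sub>0 'k)) set \<Rightarrow> ((word \<Rightarrow>\<^sub>0 'k) \<Rightarrow> 'a) set" where
  "solutions H X T = {\<mu> \<in> alg_hom (free_alg X) H. T \<subseteq> ker_cong X \<mu>}"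

definition H_closure :: "('k::field, 'a) module \<Rightarrow> nat set
    \<Rightarrow> ((word \<Rightarrow>\<^sub>0 'k) \<times> (word \<Rightarrow>\<^sub>0 'k)) set \<Rightarrow> ((word \<Rightarrow>\<^sub>0 'k) \<times> (word \<Rightarrow>\<^sub>0 'k)) set" where
  "H_closure H X T = (\<Inter>\<mu>\<in>solutions H X T. ker_cong X \<mu>)"

definition geometrically_equivalent :: "('k::field, 'a) module \<Rightarrow> ('k, 'b) module \<Rightarrow> bool" where
  "geometrically_equivalent H\<^sub>1 H\<^sub>2 \<longleftrightarrow>
     (\<forall>X. finite X \<longrightarrow> (\<forall>T. T \<subseteq> carrier (free_alg X) \<times> carrier (free_alg X) \<longrightarrow>
        H_closure H\<^sub>1 X T = H_closure H\<^sub>2 X T))"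


section \<open>The two algebras\<close>

definition H_alg :: "(rat, (word \<Rightarrow>\<^sub>0 rat) set) module" where
  "H_alg = rel_free {poly_prod (poly_prod (var 1) (var 1)) (var 2)} {1, 2}"

definition star_alg :: "'k::field \<Rightarrow> 'k \<Rightarrow> ('k, 'a) module \<Rightarrow> ('k, 'a) module" where
  "star_alg a b A = A\<lparr>mult := \<lambda>u v. a \<odot>\<^bsub>A\<^esub> (u \<otimes>\<^bsub>A\<^esub> v) \<oplus>\<^bsub>A\<^esub> b \<odot>\<^bsub>A\<^esub> (v \<otimes>\<^bsub>A\<^esub> u)\<rparr>"


section \<open>The constructions are linear algebras with the expected universal properties\<close>

lemma scalars_simps [simp]:
  "carrier scalars = UNIV" "mult scalars = (*)" "one scalars = 1" "zero scalars = 0"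
  "add scalars = (+)"
  by (simp_all add: scalars_def)

lemma cring_scalars: "cring (scalars :: 'k::field ring)"
proof (rule cringI)
  show "abelian_group (scalars :: 'k ring)"
    by (rule abelian_groupI) (auto simp: add.assoc add.commute intro: exI[of _ "- x" for x])
  show "Group.comm_monoid (scalars :: 'k ring)"
    by (rule comm_monoidI) (auto simp: mult.assoc mult.commute)
qed (auto simp: distrib_right)

lemma linear_algebraI:
  fixes A :: "('k::field, 'a) module"
  assumes "abelian_group A"
    and "\<And>c x. x \<in> carrier A \<Longrightarrow> c \<odot>\<^bsub>A\<^esub> x \<in> carrier A"
    and "\<And>c d x. x \<in> carrier A \<Longrightarrow> (c + d) \<odot>\<^bsub>A\<^esub> x = c \<odot>\<^bsub>A\<^esub> x \<oplus>\<^bsub>A\<^esub> d \<odot>\<^bsub>A\<^esub> x"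
    and "\<And>c x y. x \<in> carrier A \<Longrightarrow> y \<in> carrier A \<Longrightarrow> c \<odot>\<^bsub>A\<^esub> (x \<oplus>\<^bsub>A\<^esub> y) = c \<odot>\<^bsub>A\<^esub> x \<oplus>\<^bsub>A\<^esub> c \<odot>\<^bsub>A\<^esub> y"
    and "\<And>c d x. x \<in> carrier A \<Longrightarrow> (c * d) \<odot>\<^bsub>A\<^esub> x = c \<odot>\<^bsub>A\<^esub> (d \<odot>\<^bsub>A\<^esub> x)"
    and "\<And>x. x \<in> carrier A \<Longrightarrow> 1 \<odot>\<^bsub>A\<^esub> x = x"
    and "\<And>x y. x \<in> carrier A \<Longrightarrow> y \<in> carrier A \<Longrightarrow> x \<otimes>\<^bsub>A\<^esub> y \<in> carrier A"
    and "\<And>x y z. x \<in> carrier A \<Longrightarrow> y \<in> carrier A \<Longrightarrow> z \<in> carrier A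
          \<Longrightarrow> (x \<oplus>\<^bsub>A\<^esub> y) \<otimes>\<^bsub>A\<^esub> z = x \<otimes>\<^bsub>A\<^esub> z \<oplus>\<^bsub>A\<^esub> y \<otimes>\<^bsub>A\<^esub> z"
    and "\<And>x y z. x \<in> carrier A \<Longrightarrow> y \<in> carrier A \<Longrightarrow> z \<in> carrier A
          \<Longrightarrow> z \<otimes>\<^bsub>A\<^esub> (x \<oplus>\<^bsub>A\<^esub> y) = z \<otimes>\<^bsub>A\<^esub> x \<oplus>\<^bsub>A\<^esub> z \<otimes>\<^bsub>A\<^esub> y"
    and "\<And>c x y. x \<in> carrier A \<Longrightarrow> y \<in> carrier A \<Longrightarrow> (c \<odot>\<^bsub>A\<^esub> x) \<otimes>\<^bsub>A\<^esub> y = c \<odot>\<^bsub>A\<^esub> (x \<otimes>\<^bsub>A\<^esub> y)"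
    and "\<And>c x y. x \<in> carrier A \<Longrightarrow> y \<in> carrier A \<Longrightarrow> x \<otimes>\<^bsub>A\<^esub> (c \<odot>\<^bsub>A\<^esub> y) = c \<odot>\<^bsub>A\<^esub> (x \<otimes>\<^bsub>A\<^esub> y)"
  shows "linear_algebra A"
  by (intro linear_algebra.intro moduleI cring_scalars linear_algebra_axioms.intro)
    (use assms in simp_all)

lemma lookup_map_scale [simp]:
  "Poly_Mapping.lookup (Poly_Mapping.map ((*) (c::'k::field)) p) t = c * Poly_Mapping.lookup p t"
  by transfer (simp add: when_def)

lemma lookup_poly_prod:
  "Poly_Mapping.lookup (poly_prod p q) w =
     (case w of Sym i \<Rightarrow> 0 | Prod s t \<Rightarrow> Poly_Mapping.lookup p s * Poly_Mapping.lookup q t)"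
proof (cases w)
  case (Sym i)
  then show ?thesis by (simp add: poly_prod_def lookup_sum lookup_single)
next
  case (Prod s t)
  have "Poly_Mapping.lookup (poly_prod p q) w =
     (\<Sum>s'\<in>Poly_Mapping.keys p. \<Sum>t'\<in>Poly_Mapping.keys q.
       if t' = t then (if s' = s then Poly_Mapping.lookup p s' * Poly_Mapping.lookup q t' else 0) else 0)"
    unfolding poly_prod_def lookup_sum lookup_single Prod
    by (intro sum.cong refl) (auto simp: when_def)
  also have "\<dots> = (\<Sum>s'\<in>Poly_Mapping.keys p.
      if s' = s then Poly_Mapping.lookup p s' * Poly_Mapping.lookup q t else 0)"
    by (intro sum.cong refl) (simp add: sum.delta in_keys_iff)
  also have "\<dots> = Poly_Mapping.lookup p s * Poly_Mapping.lookup q t"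
    by (simp add: sum.delta in_keys_iff)
  finally show ?thesis by (simp add: Prod)
qed

lemma free_alg_simps [simp]:
  "mult (free_alg X) = poly_prod" "zero (free_alg X) = 0" "add (free_alg X) = (+)"
  "smult (free_alg X) = (\<lambda>c. Poly_Mapping.map ((*) c))"
  by (simp_all add: free_alg_def)

lemma free_alg_carrier:
  "p \<in> carrier (free_alg X) \<longleftrightarrow> (\<forall>t. \<not> symbols t \<subseteq> X \<longrightarrow> Poly_Mapping.lookup p t = 0)"
  by (auto simp: free_alg_def in_keys_iff)

lemma linear_algebra_free_alg: "linear_algebra (free_alg X :: ('k::field, word \<Rightarrow>\<^sub>0 'k) module)"
proof (rule linear_algebraI)
  show "abelian_group (free_alg X :: ('k, word \<Rightarrow>\<^sub>0 'k) module)"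
  proof (rule abelian_groupI)
    fix p :: "word \<Rightarrow>\<^sub>0 'k" assume "p \<in> carrier (free_alg X)"
    then have "- p \<in> carrier (free_alg X)" by (simp add: free_alg_carrier)
    then show "\<exists>q\<in>carrier (free_alg X). q \<oplus>\<^bsub>free_alg X\<^esub> p = \<zero>\<^bsub>free_alg X\<^esub>"
      by (intro bexI[of _ "- p"]) auto
  qed (auto simp: free_alg_carrier lookup_add algebra_simps)
qed (auto simp: free_alg_carrier lookup_poly_prod lookup_add distrib_left distrib_right
       split: word.splits intro!: poly_mapping_eqI)

lemma linear_algebra_star_alg:
  fixes A :: "('k::field, 'a) module"
  assumes "linear_algebra A"
  shows "linear_algebra (star_alg a b A)"
proof -
  interpret linear_algebra A by fact
  note sm = smult_closed[simplified] smult_r_distr[simplified] smult_l_distr[simplified]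
    smult_assoc1[simplified]
  show ?thesis
  proof (rule linear_algebraI)
    show "abelian_group (star_alg a b A)"
      by (rule abelian_groupI)
        (auto simp: star_alg_def M.a_ac intro: bexI[of _ "\<ominus>\<^bsub>A\<^esub> x" for x] M.l_neg)
    fix x y :: 'a and c :: 'k
    assume xy: "x \<in> carrier (star_alg a b A)" "y \<in> carrier (star_alg a b A)"
    show "x \<otimes>\<^bsub>star_alg a b A\<^esub> y \<in> carrier (star_alg a b A)"
      using xy by (simp add: star_alg_def sm prod_closed)
    have comm: "a \<odot>\<^bsub>A\<^esub> (c \<odot>\<^bsub>A\<^esub> z) = c \<odot>\<^bsub>A\<^esub> (a \<odot>\<^bsub>A\<^esub> z)" if "z \<in> carrier A" for z and a c :: 'k
      using that by (simp flip: sm(4)) (simp add: mult.commute)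
    show "(c \<odot>\<^bsub>star_alg a b A\<^esub> x) \<otimes>\<^bsub>star_alg a b A\<^esub> y = c \<odot>\<^bsub>star_alg a b A\<^esub> (x \<otimes>\<^bsub>star_alg a b A\<^esub> y)"
      "x \<otimes>\<^bsub>star_alg a b A\<^esub> (c \<odot>\<^bsub>star_alg a b A\<^esub> y) = c \<odot>\<^bsub>star_alg a b A\<^esub> (x \<otimes>\<^bsub>star_alg a b A\<^esub> y)"
      using xy by (simp_all add: star_alg_def sm(1,2) prod_closed prod_smult_l prod_smult_r comm[of _ _ c])
    fix z assume z: "z \<in> carrier (star_alg a b A)"
    show "(x \<oplus>\<^bsub>star_alg a b A\<^esub> y) \<otimes>\<^bsub>star_alg a b A\<^esub> z =
        x \<otimes>\<^bsub>star_alg a b A\<^esub> z \<oplus>\<^bsub>star_alg a b A\<^esub> y \<otimes>\<^bsub>star_alg a b A\<^esub> z"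
      "z \<otimes>\<^bsub>star_alg a b A\<^esub> (x \<oplus>\<^bsub>star_alg a b A\<^esub> y) =
        z \<otimes>\<^bsub>star_alg a b A\<^esub> x \<oplus>\<^bsub>star_alg a b A\<^esub> z \<otimes>\<^bsub>star_alg a b A\<^esub> y"
      using xy z by (simp_all add: star_alg_def sm(1,2) prod_closed prod_l_distr prod_r_distr M.a_ac)
  qed (auto simp: star_alg_def sm smult_one[simplified])
qed

lemma alg_homD:
  assumes "\<mu> \<in> alg_hom A B"
  shows "x \<in> carrier A \<Longrightarrow> \<mu> x \<in> carrier B"
    and "x \<in> carrier A \<Longrightarrow> y \<in> carrier A \<Longrightarrow> \<mu> (x \<oplus>\<^bsub>A\<^esub> y) = \<mu> x \<oplus>\<^bsub>B\<^esub> \<mu> y"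
    and "x \<in> carrier A \<Longrightarrow> \<mu> (c \<odot>\<^bsub>A\<^esub> x) = c \<odot>\<^bsub>B\<^esub> \<mu> x"
    and "x \<in> carrier A \<Longrightarrow> y \<in> carrier A \<Longrightarrow> \<mu> (x \<otimes>\<^bsub>A\<^esub> y) = \<mu> x \<otimes>\<^bsub>B\<^esub> \<mu> y"
  using assms by (auto simp: alg_hom_def)

lemma alg_hom_comp:
  assumes "\<mu> \<in> alg_hom A B" "\<nu> \<in> alg_hom B C"
  shows "\<nu> \<circ> \<mu> \<in> alg_hom A C"
  using assms by (auto simp: alg_hom_def Pi_iff)

lemma alg_hom_zero:
  assumes "linear_algebra A" "linear_algebra B" "\<mu> \<in> alg_hom A B"
  shows "\<mu> \<zero>\<^bsub>A\<^esub> = \<zero>\<^bsub>B\<^esub>"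
proof -
  interpret A: linear_algebra A by fact
  interpret B: linear_algebra B by fact
  have "\<mu> (0 \<odot>\<^bsub>A\<^esub> \<zero>\<^bsub>A\<^esub>) = 0 \<odot>\<^bsub>B\<^esub> \<mu> \<zero>\<^bsub>A\<^esub>"
    by (rule alg_homD(3)[OF assms(3)]) simp
  then show ?thesis
    using A.smult_l_null[of "\<zero>\<^bsub>A\<^esub>"] B.smult_l_null[of "\<mu> \<zero>\<^bsub>A\<^esub>"] alg_homD(1)[OF assms(3)] by simp
qed

primrec word_eval :: "('k, 'a) module \<Rightarrow> (nat \<Rightarrow> 'a) \<Rightarrow> word \<Rightarrow> 'a" where
  "word_eval B f (Sym i) = f i"
| "word_eval B f (Prod s t) = word_eval B f s \<otimes>\<^bsub>B\<^esub> word_eval B f t"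

definition poly_eval :: "('k::field, 'a) module \<Rightarrow> (nat \<Rightarrow> 'a) \<Rightarrow> (word \<Rightarrow>\<^sub>0 'k) \<Rightarrow> 'a" where
  "poly_eval B f p =
     (\<Oplus>\<^bsub>B\<^esub>t\<in>Poly_Mapping.keys p. Poly_Mapping.lookup p t \<odot>\<^bsub>B\<^esub> word_eval B f t)"

lemma poly_induct [consumes 1, case_names zero add]:
  fixes p :: "word \<Rightarrow>\<^sub>0 'k::field"
  assumes p: "p \<in> carrier (free_alg X)"
    and zero: "P 0"
    and add: "\<And>p t c. p \<in> carrier (free_alg X) \<Longrightarrow> symbols t \<subseteq> X \<Longrightarrow> P p
       \<Longrightarrow> P (p + Poly_Mapping.single t c)"
  shows "P p"
proof -
  have *: "(\<Sum>t\<in>S. Poly_Mapping.single t (Poly_Mapping.lookup p t)) \<in> carrier (free_alg X) \<and>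
      P (\<Sum>t\<in>S. Poly_Mapping.single t (Poly_Mapping.lookup p t))"
    if "finite S" "S \<subseteq> Poly_Mapping.keys p" for S
    using that
  proof (induction S rule: finite_induct)
    case empty
    then show ?case by (simp add: zero free_alg_carrier)
  next
    case (insert t S)
    then have "symbols t \<subseteq> X" using p by (auto simp: free_alg_def)
    with insert show ?case
      using add[of "\<Sum>t\<in>S. Poly_Mapping.single t (Poly_Mapping.lookup p t)" t]
      by (auto simp: free_alg_carrier lookup_add lookup_single when_def add.commute)
  qed
  have "p = (\<Sum>t\<in>Poly_Mapping.keys p. Poly_Mapping.single t (Poly_Mapping.lookup p t))"
    by (rule poly_mapping_eqI) (simp add: lookup_sum lookup_single when_def in_keys_iff)
  with *[of "Poly_Mapping.keys p"] show ?thesis by simp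
qed

lemma single_carrier [simp]:
  "symbols t \<subseteq> X \<Longrightarrow> Poly_Mapping.single t c \<in> carrier (free_alg X)"
  by (auto simp: free_alg_carrier lookup_single when_def)

lemma var_carrier: "i \<in> X \<Longrightarrow> var i \<in> carrier (free_alg X)"
  by (simp add: var_def)

lemma alg_hom_free_unique:
  assumes B: "linear_algebra B"
    and \<mu>: "\<mu> \<in> alg_hom (free_alg X) B" and \<nu>: "\<nu> \<in> alg_hom (free_alg X) B"
    and eq: "\<And>i. i \<in> X \<Longrightarrow> \<mu> (var i) = \<nu> (var i)" and p: "p \<in> carrier (free_alg X)"
  shows "\<mu> p = \<nu> p"
proof -
  have word: "\<mu> (Poly_Mapping.single t 1) = \<nu> (Poly_Mapping.single t 1)" if "symbols t \<subseteq> X" for t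
    using that
  proof (induction t)
    case (Sym i)
    then show ?case using eq by (simp add: var_def)
  next
    case (Prod s t)
    have "Poly_Mapping.single (Prod s t) 1 =
        poly_prod (Poly_Mapping.single s 1) (Poly_Mapping.single t (1::'b))"
      by (simp add: poly_prod_def)
    with Prod show ?case
      using alg_homD(4)[OF \<mu>, of "Poly_Mapping.single s 1" "Poly_Mapping.single t 1"]
        alg_homD(4)[OF \<nu>, of "Poly_Mapping.single s 1" "Poly_Mapping.single t 1"]
      by simp
  qed
  from p show ?thesis
  proof (induction p rule: poly_induct)
    case zero
    then show ?case
      using alg_hom_zero[OF linear_algebra_free_alg B \<mu>]
        alg_hom_zero[OF linear_algebra_free_alg B \<nu>] by simp
  next
    case (add p t c)
    have "Poly_Mapping.single t c = Poly_Mapping.map ((*) c) (Poly_Mapping.single t 1)"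
      by (rule poly_mapping_eqI) (simp add: lookup_single when_def)
    then have "\<mu> (Poly_Mapping.single t c) = \<nu> (Poly_Mapping.single t c)"
      using alg_homD(3)[OF \<mu>, of "Poly_Mapping.single t 1" c]
        alg_homD(3)[OF \<nu>, of "Poly_Mapping.single t 1" c] word add.hyps by simp
    then show ?case
      using alg_homD(2)[OF \<mu>, of p "Poly_Mapping.single t c"]
        alg_homD(2)[OF \<nu>, of p "Poly_Mapping.single t c"] add by simp
  qed
qed

lemma poly_eval_hom:
  fixes B :: "('k::field, 'a) module"
  assumes "linear_algebra B" and f: "\<And>i. f i \<in> carrier B"
  shows "poly_eval B f \<in> alg_hom (free_alg X) B" and "poly_eval B f (var i) = f i"
proof -
  interpret B: linear_algebra B by fact
  note sm = B.smult_closed[simplified] B.smult_r_distr[simplified] B.smult_l_distr[simplified]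
    B.smult_assoc1[simplified]
  have w [simp]: "word_eval B f t \<in> carrier B" for t
    by (induction t) (auto simp: f B.prod_closed)
  have ev: "poly_eval B f p = (\<Oplus>\<^bsub>B\<^esub>t\<in>S. Poly_Mapping.lookup p t \<odot>\<^bsub>B\<^esub> word_eval B f t)"
    if "finite S" "Poly_Mapping.keys p \<subseteq> S" for S p
    unfolding poly_eval_def using that B.smult_l_null
    by (intro B.M.add.finprod_mono_neutral_cong_left) (auto simp: sm in_keys_iff)
  have cl [simp]: "poly_eval B f p \<in> carrier B" for p
    unfolding poly_eval_def by (intro B.M.finsum_closed) (auto simp: sm)
  have add: "poly_eval B f (p + q) = poly_eval B f p \<oplus>\<^bsub>B\<^esub> poly_eval B f q" for p q
  proof -
    let ?S = "Poly_Mapping.keys p \<union> Poly_Mapping.keys q"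
    have "poly_eval B f (p + q) = (\<Oplus>\<^bsub>B\<^esub>t\<in>?S. Poly_Mapping.lookup p t \<odot>\<^bsub>B\<^esub> word_eval B f t
        \<oplus>\<^bsub>B\<^esub> Poly_Mapping.lookup q t \<odot>\<^bsub>B\<^esub> word_eval B f t)"
      using ev[of ?S "p + q"] Poly_Mapping.keys_add[of p q] by (simp add: lookup_add sm)
    also have "\<dots> = poly_eval B f p \<oplus>\<^bsub>B\<^esub> poly_eval B f q"
      by (subst B.M.finsum_addf) (auto simp: sm ev[of ?S p] ev[of ?S q])
    finally show ?thesis .
  qed
  have single: "poly_eval B f (Poly_Mapping.single t c) = c \<odot>\<^bsub>B\<^esub> word_eval B f t" for t c
    by (subst ev[of "{t}"]) (auto simp: sm)
  have zero: "poly_eval B f 0 = \<zero>\<^bsub>B\<^esub>"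
    by (simp add: poly_eval_def)
  have map_add: "Poly_Mapping.map ((*) c) (p + q) =
      Poly_Mapping.map ((*) c) p + Poly_Mapping.map ((*) c) q" for c :: 'k and p q :: "word \<Rightarrow>\<^sub>0 'k"
    by (rule poly_mapping_eqI) (simp add: lookup_add distrib_left)
  have map_single: "Poly_Mapping.map ((*) c) (Poly_Mapping.single t d) =
      Poly_Mapping.single t (c * d)" for c d :: 'k and t :: word
    by (rule poly_mapping_eqI) (simp add: lookup_single when_def)
  have UNIVc: "p \<in> carrier (free_alg UNIV)" for p :: "word \<Rightarrow>\<^sub>0 'k"
    by (simp add: free_alg_carrier)
  have smult: "poly_eval B f (Poly_Mapping.map ((*) c) p) = c \<odot>\<^bsub>B\<^esub> poly_eval B f p" for c p
    using UNIVc[of p]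
  proof (induction p rule: poly_induct)
    case zero
    have "Poly_Mapping.map ((*) c) (0 :: word \<Rightarrow>\<^sub>0 'k) = 0"
      by (rule poly_mapping_eqI) simp
    then show ?case using B.smult_r_null[of c] by (simp add: \<open>poly_eval B f 0 = _\<close>)
  qed (simp add: map_add map_single add single sm)
  interpret F: linear_algebra "free_alg UNIV :: ('k, word \<Rightarrow>\<^sub>0 'k) module"
    by (rule linear_algebra_free_alg)
  have dl: "poly_prod (p + q) r = poly_prod p r + poly_prod q r"
    and dr: "poly_prod r (p + q) = poly_prod r p + poly_prod r q" for p q r :: "word \<Rightarrow>\<^sub>0 'k"
    using F.prod_l_distr[of p q r] F.prod_r_distr[of p q r] UNIVc by simp_all
  have z: "poly_prod p 0 = 0" "poly_prod 0 p = 0" for p :: "word \<Rightarrow>\<^sub>0 'k"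
    by (simp_all add: poly_prod_def)
  have Bz: "x \<otimes>\<^bsub>B\<^esub> \<zero>\<^bsub>B\<^esub> = \<zero>\<^bsub>B\<^esub>" "\<zero>\<^bsub>B\<^esub> \<otimes>\<^bsub>B\<^esub> x = \<zero>\<^bsub>B\<^esub>" if "x \<in> carrier B" for x
    using that B.prod_smult_r[of x "\<zero>\<^bsub>B\<^esub>" 0] B.prod_smult_l[of "\<zero>\<^bsub>B\<^esub>" x 0] B.smult_l_null
    by (simp_all add: B.prod_closed)
  have mult1: "poly_eval B f (poly_prod p (Poly_Mapping.single t c)) =
      poly_eval B f p \<otimes>\<^bsub>B\<^esub> (c \<odot>\<^bsub>B\<^esub> word_eval B f t)" for p t c
    using UNIVc[of p]
  proof (induction p rule: poly_induct)
    case zero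
    then show ?case by (simp add: z Bz sm \<open>poly_eval B f 0 = _\<close>)
  next
    case (add p s d)
    have "poly_prod (Poly_Mapping.single s d) (Poly_Mapping.single t c) =
        Poly_Mapping.single (Prod s t) (d * c)"
      by (simp add: poly_prod_def)
    with add show ?case
      by (simp add: dl \<open>\<And>p q. poly_eval B f (p + q) = _\<close> single B.prod_l_distr sm(1,2) B.prod_smult_l
          B.prod_smult_r B.prod_closed flip: sm(4)) (simp add: mult.commute)
  qed
  have mult: "poly_eval B f (poly_prod p q) = poly_eval B f p \<otimes>\<^bsub>B\<^esub> poly_eval B f q" for p q
    using UNIVc[of q]
  proof (induction q rule: poly_induct)
    case zero
    then show ?case by (simp add: z Bz \<open>poly_eval B f 0 = _\<close>)
  next
    case (add q t c)
    then show ?case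
      by (simp add: dr \<open>\<And>p q. poly_eval B f (p + q) = _\<close> mult1 single B.prod_r_distr sm)
  qed
  show "poly_eval B f \<in> alg_hom (free_alg X) B"
    by (simp add: alg_hom_def add smult mult)
  show "poly_eval B f (var i) = f i"
    using B.smult_one[of "f i"] f by (simp add: var_def single)
qed

theorem free_alg_universal:
  assumes B: "linear_algebra B" and f: "\<And>i. i \<in> X \<Longrightarrow> f i \<in> carrier B"
  shows "\<exists>\<mu>\<in>alg_hom (free_alg X) B. \<forall>i\<in>X. \<mu> (var i) = f i"
proof -
  interpret linear_algebra B by fact
  let ?g = "\<lambda>i. if i \<in> X then f i else \<zero>\<^bsub>B\<^esub>"
  have "\<And>i. ?g i \<in> carrier B" using f by simp
  from poly_eval_hom[OF B this] show ?thesis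
    by (intro bexI[of _ "poly_eval B ?g"]) auto
qed

lemma alg_idealD:
  assumes "linear_algebra A" "alg_ideal J A"
  shows "J \<subseteq> carrier A" "\<zero>\<^bsub>A\<^esub> \<in> J"
    "x \<in> J \<Longrightarrow> y \<in> J \<Longrightarrow> x \<oplus>\<^bsub>A\<^esub> y \<in> J" "x \<in> J \<Longrightarrow> \<ominus>\<^bsub>A\<^esub> x \<in> J" "x \<in> J \<Longrightarrow> c \<odot>\<^bsub>A\<^esub> x \<in> J"
    "x \<in> carrier A \<Longrightarrow> y \<in> J \<Longrightarrow> x \<otimes>\<^bsub>A\<^esub> y \<in> J" "x \<in> carrier A \<Longrightarrow> y \<in> J \<Longrightarrow> y \<otimes>\<^bsub>A\<^esub> x \<in> J"
proof -
  interpret linear_algebra A by fact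
  have S: "submodule J scalars A" using assms by (simp add: alg_ideal_def)
  show "\<zero>\<^bsub>A\<^esub> \<in> J"
    using subgroup.one_closed[OF submodule.axioms(1)[OF S]] by simp
  show "J \<subseteq> carrier A" "x \<in> J \<Longrightarrow> y \<in> J \<Longrightarrow> x \<oplus>\<^bsub>A\<^esub> y \<in> J" "x \<in> J \<Longrightarrow> \<ominus>\<^bsub>A\<^esub> x \<in> J"
    "x \<in> J \<Longrightarrow> c \<odot>\<^bsub>A\<^esub> x \<in> J"
    using submoduleE[OF S] by auto
  show "x \<in> carrier A \<Longrightarrow> y \<in> J \<Longrightarrow> x \<otimes>\<^bsub>A\<^esub> y \<in> J" "x \<in> carrier A \<Longrightarrow> y \<in> J \<Longrightarrow> y \<otimes>\<^bsub>A\<^esub> x \<in> J"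
    using assms(2) by (auto simp: alg_ideal_def)
qed

lemma alg_quot_facts:
  fixes A :: "('k::field, 'a) module"
  assumes A: "linear_algebra A" and J: "alg_ideal J A"
  shows "linear_algebra (alg_quot A J)"
    and "(\<lambda>x. J +>\<^bsub>A\<^esub> x) \<in> alg_hom A (alg_quot A J)"
    and "carrier (alg_quot A J) = (\<lambda>x. J +>\<^bsub>A\<^esub> x) ` carrier A"
    and "\<And>x y. x \<in> carrier A \<Longrightarrow> y \<in> carrier A \<Longrightarrow>
      J +>\<^bsub>A\<^esub> x = J +>\<^bsub>A\<^esub> y \<longleftrightarrow> x \<ominus>\<^bsub>A\<^esub> y \<in> J"
proof -
  interpret linear_algebra A by fact
  note sm = smult_closed[simplified] smult_r_distr[simplified] smult_l_distr[simplified]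
    smult_assoc1[simplified]
  note JD = alg_idealD[OF A J]
  note Jc = subsetD[OF JD(1)]
  interpret S: abelian_subgroup J A
    using J by (intro abelian_subgroupI3 additive_subgroup.intro M.abelian_group_axioms)
      (simp add: alg_ideal_def submodule_def)
  show eq: "J +>\<^bsub>A\<^esub> x = J +>\<^bsub>A\<^esub> y \<longleftrightarrow> x \<ominus>\<^bsub>A\<^esub> y \<in> J" if "x \<in> carrier A" "y \<in> carrier A" for x y
    using that by (metis S.a_repr_independence' S.a_rcos_module S.a_rcos_self M.minus_eq)
  have mem: "u \<in> J +>\<^bsub>A\<^esub> x \<longleftrightarrow> (\<exists>j\<in>J. u = j \<oplus>\<^bsub>A\<^esub> x)" for u x
    by (auto simp: a_r_coset_def')
  have repr: "J +>\<^bsub>A\<^esub> (j \<oplus>\<^bsub>A\<^esub> x) = J +>\<^bsub>A\<^esub> x" if "j \<in> J" "x \<in> carrier A" for j x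
    using that by (metis S.a_repr_independence' mem)
  show car: "carrier (alg_quot A J) = (\<lambda>x. J +>\<^bsub>A\<^esub> x) ` carrier A"
    by (auto simp: alg_quot_def A_RCOSETS_def')
  have add: "(J +>\<^bsub>A\<^esub> x) \<oplus>\<^bsub>alg_quot A J\<^esub> (J +>\<^bsub>A\<^esub> y) = J +>\<^bsub>A\<^esub> (x \<oplus>\<^bsub>A\<^esub> y)"
    if "x \<in> carrier A" "y \<in> carrier A" for x y
    using that by (simp add: alg_quot_def S.a_rcos_sum)
  have zero: "\<zero>\<^bsub>alg_quot A J\<^esub> = J +>\<^bsub>A\<^esub> \<zero>\<^bsub>A\<^esub>"
    by (simp add: alg_quot_def M.a_coset_add_zero JD(1))
  have const: "(\<Union>u\<in>S. g u) = v" if "x \<in> S" "\<And>u. u \<in> S \<Longrightarrow> g u = v"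
    for S and g :: "'a \<Rightarrow> 'a set" and v x
    using that by blast
  have smul: "c \<odot>\<^bsub>alg_quot A J\<^esub> (J +>\<^bsub>A\<^esub> x) = J +>\<^bsub>A\<^esub> (c \<odot>\<^bsub>A\<^esub> x)" if x: "x \<in> carrier A" for c x
  proof -
    have "J +>\<^bsub>A\<^esub> (c \<odot>\<^bsub>A\<^esub> u) = J +>\<^bsub>A\<^esub> (c \<odot>\<^bsub>A\<^esub> x)" if "u \<in> J +>\<^bsub>A\<^esub> x" for u
    proof -
      obtain j where j: "j \<in> J" "u = j \<oplus>\<^bsub>A\<^esub> x" using \<open>u \<in> J +>\<^bsub>A\<^esub> x\<close> by (auto simp: mem)
      then have "c \<odot>\<^bsub>A\<^esub> u = c \<odot>\<^bsub>A\<^esub> j \<oplus>\<^bsub>A\<^esub> c \<odot>\<^bsub>A\<^esub> x" using x by (simp add: sm(2) Jc)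
      then show ?thesis using j x by (simp add: repr JD(5) sm(1))
    qed
    moreover have "x \<in> J +>\<^bsub>A\<^esub> x" using x by (rule S.a_rcos_self)
    ultimately have "(\<Union>u\<in>J +>\<^bsub>A\<^esub> x. J +>\<^bsub>A\<^esub> (c \<odot>\<^bsub>A\<^esub> u)) = J +>\<^bsub>A\<^esub> (c \<odot>\<^bsub>A\<^esub> x)"
      by (intro const[of x]) blast+
    then show ?thesis by (simp add: alg_quot_def)
  qed
  have mul: "(J +>\<^bsub>A\<^esub> x) \<otimes>\<^bsub>alg_quot A J\<^esub> (J +>\<^bsub>A\<^esub> y) = J +>\<^bsub>A\<^esub> (x \<otimes>\<^bsub>A\<^esub> y)"
    if x: "x \<in> carrier A" and y: "y \<in> carrier A" for x y
  proof -
    have "J +>\<^bsub>A\<^esub> (u \<otimes>\<^bsub>A\<^esub> v) = J +>\<^bsub>A\<^esub> (x \<otimes>\<^bsub>A\<^esub> y)" if uv: "u \<in> J +>\<^bsub>A\<^esub> x" "v \<in> J +>\<^bsub>A\<^esub> y" for u v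
    proof -
      obtain i j where ij: "i \<in> J" "j \<in> J" "u = i \<oplus>\<^bsub>A\<^esub> x" "v = j \<oplus>\<^bsub>A\<^esub> y"
        using uv by (auto simp: mem)
      have "u \<otimes>\<^bsub>A\<^esub> v = i \<otimes>\<^bsub>A\<^esub> v \<oplus>\<^bsub>A\<^esub> (x \<otimes>\<^bsub>A\<^esub> j \<oplus>\<^bsub>A\<^esub> x \<otimes>\<^bsub>A\<^esub> y)"
        using ij x y by (simp add: prod_l_distr[of i] prod_r_distr[of j y x] prod_closed Jc)
      then show ?thesis
        using ij x y by (simp add: repr JD(3,6,7) Jc prod_closed flip: M.a_assoc)
    qed
    moreover have "x \<in> J +>\<^bsub>A\<^esub> x" "y \<in> J +>\<^bsub>A\<^esub> y" using x y by (auto intro: S.a_rcos_self)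
    ultimately have "(\<Union>u\<in>J +>\<^bsub>A\<^esub> x. \<Union>v\<in>J +>\<^bsub>A\<^esub> y. J +>\<^bsub>A\<^esub> (u \<otimes>\<^bsub>A\<^esub> v)) = J +>\<^bsub>A\<^esub> (x \<otimes>\<^bsub>A\<^esub> y)"
      using const[of x "J +>\<^bsub>A\<^esub> x"] const[of y "J +>\<^bsub>A\<^esub> y"] by meson
    then show ?thesis by (simp add: alg_quot_def rcoset_mult_def)
  qed
  show "(\<lambda>x. J +>\<^bsub>A\<^esub> x) \<in> alg_hom A (alg_quot A J)"
    by (auto simp: alg_hom_def car add smul mul)
  show "linear_algebra (alg_quot A J)"
  proof (rule linear_algebraI)
    show "abelian_group (alg_quot A J)"
    proof (rule abelian_groupI)
      fix x assume "x \<in> carrier (alg_quot A J)"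
      then obtain u where u: "u \<in> carrier A" "x = J +>\<^bsub>A\<^esub> u" by (auto simp: car)
      then show "\<exists>y\<in>carrier (alg_quot A J). y \<oplus>\<^bsub>alg_quot A J\<^esub> x = \<zero>\<^bsub>alg_quot A J\<^esub>"
        by (intro bexI[of _ "J +>\<^bsub>A\<^esub> (\<ominus>\<^bsub>A\<^esub> u)"]) (auto simp: car add zero M.l_neg)
    next
      fix x y z assume "x \<in> carrier (alg_quot A J)" "y \<in> carrier (alg_quot A J)"
        "z \<in> carrier (alg_quot A J)"
      then obtain u v w where [simp]: "x = J +>\<^bsub>A\<^esub> u" "y = J +>\<^bsub>A\<^esub> v" "z = J +>\<^bsub>A\<^esub> w"
        and uvw [simp]: "u \<in> carrier A" "v \<in> carrier A" "w \<in> carrier A"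
        by (auto simp: car)
      show "x \<oplus>\<^bsub>alg_quot A J\<^esub> y \<in> carrier (alg_quot A J)" by (simp add: car add)
      show "x \<oplus>\<^bsub>alg_quot A J\<^esub> y \<oplus>\<^bsub>alg_quot A J\<^esub> z = x \<oplus>\<^bsub>alg_quot A J\<^esub> (y \<oplus>\<^bsub>alg_quot A J\<^esub> z)"
        by (simp add: add M.a_assoc)
      show "x \<oplus>\<^bsub>alg_quot A J\<^esub> y = y \<oplus>\<^bsub>alg_quot A J\<^esub> x" by (simp add: add M.a_comm)
      show "\<zero>\<^bsub>alg_quot A J\<^esub> \<oplus>\<^bsub>alg_quot A J\<^esub> x = x" by (simp add: zero add)
    qed (simp add: zero car)
  next
    fix c d x y z assume "x \<in> carrier (alg_quot A J)" "y \<in> carrier (alg_quot A J)"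
      "z \<in> carrier (alg_quot A J)"
    then obtain u v w where [simp]: "x = J +>\<^bsub>A\<^esub> u" "y = J +>\<^bsub>A\<^esub> v" "z = J +>\<^bsub>A\<^esub> w"
      and uvw [simp]: "u \<in> carrier A" "v \<in> carrier A" "w \<in> carrier A"
      by (auto simp: car)
    show "x \<otimes>\<^bsub>alg_quot A J\<^esub> y \<in> carrier (alg_quot A J)"
      by (auto simp: car mul prod_closed)
    show "(x \<oplus>\<^bsub>alg_quot A J\<^esub> y) \<otimes>\<^bsub>alg_quot A J\<^esub> z =
        x \<otimes>\<^bsub>alg_quot A J\<^esub> z \<oplus>\<^bsub>alg_quot A J\<^esub> y \<otimes>\<^bsub>alg_quot A J\<^esub> z"
      "z \<otimes>\<^bsub>alg_quot A J\<^esub> (x \<oplus>\<^bsub>alg_quot A J\<^esub> y) =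
        z \<otimes>\<^bsub>alg_quot A J\<^esub> x \<oplus>\<^bsub>alg_quot A J\<^esub> z \<otimes>\<^bsub>alg_quot A J\<^esub> y"
      by (simp_all add: add mul prod_closed prod_l_distr prod_r_distr)
    show "(c \<odot>\<^bsub>alg_quot A J\<^esub> x) \<otimes>\<^bsub>alg_quot A J\<^esub> y = c \<odot>\<^bsub>alg_quot A J\<^esub> (x \<otimes>\<^bsub>alg_quot A J\<^esub> y)"
      "x \<otimes>\<^bsub>alg_quot A J\<^esub> (c \<odot>\<^bsub>alg_quot A J\<^esub> y) = c \<odot>\<^bsub>alg_quot A J\<^esub> (x \<otimes>\<^bsub>alg_quot A J\<^esub> y)"
      by (simp_all add: smul mul sm(1) prod_closed prod_smult_l prod_smult_r)
    show "c \<odot>\<^bsub>alg_quot A J\<^esub> x \<in> carrier (alg_quot A J)"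
      by (simp add: smul car sm(1))
    show "(c + d) \<odot>\<^bsub>alg_quot A J\<^esub> x = c \<odot>\<^bsub>alg_quot A J\<^esub> x \<oplus>\<^bsub>alg_quot A J\<^esub> d \<odot>\<^bsub>alg_quot A J\<^esub> x"
      by (simp add: smul add sm(1,3))
    show "c \<odot>\<^bsub>alg_quot A J\<^esub> (x \<oplus>\<^bsub>alg_quot A J\<^esub> y) = c \<odot>\<^bsub>alg_quot A J\<^esub> x \<oplus>\<^bsub>alg_quot A J\<^esub> c \<odot>\<^bsub>alg_quot A J\<^esub> y"
      by (simp add: smul add sm(1,2))
    show "(c * d) \<odot>\<^bsub>alg_quot A J\<^esub> x = c \<odot>\<^bsub>alg_quot A J\<^esub> (d \<odot>\<^bsub>alg_quot A J\<^esub> x)"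
      by (simp add: smul sm(1,4))
    show "1 \<odot>\<^bsub>alg_quot A J\<^esub> x = x"
      by (simp add: smul smult_one[simplified])
  qed
qed

lemma alg_ideal_Inter:
  assumes A: "linear_algebra A" and J: "\<And>J. J \<in> \<J> \<Longrightarrow> alg_ideal J A" and ne: "\<J> \<noteq> {}"
  shows "alg_ideal (\<Inter>\<J>) A"
proof -
  interpret linear_algebra A by fact
  note D = alg_idealD[OF A J]
  obtain J0 where J0: "J0 \<in> \<J>" using ne by blast
  have "submodule (\<Inter>\<J>) scalars A"
  proof (rule submoduleI)
    show "\<Inter>\<J> \<subseteq> carrier A" using J0 D(1) by blast
  qed (use D(2-5) in blast)+
  moreover have "x \<otimes>\<^bsub>A\<^esub> y \<in> \<Inter>\<J> \<and> y \<otimes>\<^bsub>A\<^esub> x \<in> \<Inter>\<J>" if "x \<in> carrier A" "y \<in> \<Inter>\<J>" for x y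
    using D(6,7)[OF _ that(1)] that(2) by blast
  ultimately show ?thesis by (simp add: alg_ideal_def)
qed

lemma alg_ideal_carrier:
  assumes "linear_algebra A"
  shows "alg_ideal (carrier A) A"
proof -
  interpret linear_algebra A by fact
  show ?thesis by (simp add: alg_ideal_def carrier_is_submodule prod_closed)
qed

lemma alg_ideal_kernel:
  assumes A: "linear_algebra A" and B: "linear_algebra B" and \<mu>: "\<mu> \<in> alg_hom A B"
  shows "alg_ideal {x \<in> carrier A. \<mu> x = \<zero>\<^bsub>B\<^esub>} A"
proof -
  interpret A: linear_algebra A by fact
  interpret B: linear_algebra B by fact
  note h = alg_homD[OF \<mu>]
  have inv: "\<mu> (\<ominus>\<^bsub>A\<^esub> x) = \<ominus>\<^bsub>B\<^esub> \<mu> x" if "x \<in> carrier A" for x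
    using that h(2)[of "\<ominus>\<^bsub>A\<^esub> x" x] h(1) alg_hom_zero[OF A B \<mu>]
    by (metis A.M.a_inv_closed A.M.l_neg B.M.minus_equality)
  have Bz: "x \<otimes>\<^bsub>B\<^esub> \<zero>\<^bsub>B\<^esub> = \<zero>\<^bsub>B\<^esub>" "\<zero>\<^bsub>B\<^esub> \<otimes>\<^bsub>B\<^esub> x = \<zero>\<^bsub>B\<^esub>" if "x \<in> carrier B" for x
    using that B.prod_smult_r[of x "\<zero>\<^bsub>B\<^esub>" 0] B.prod_smult_l[of "\<zero>\<^bsub>B\<^esub>" x 0] B.smult_l_null
    by (simp_all add: B.prod_closed)
  have "submodule {x \<in> carrier A. \<mu> x = \<zero>\<^bsub>B\<^esub>} scalars A"
    using h A.smult_closed B.smult_r_null alg_hom_zero[OF A B \<mu>] inv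
    by (intro A.submoduleI) auto
  then show ?thesis
    using h A.prod_closed Bz by (auto simp: alg_ideal_def)
qed

lemma verbal_ideal:
  shows "alg_ideal (verbal_ideal E X) (free_alg X)"
    and "\<phi> \<in> alg_hom (free_alg UNIV) (free_alg X) \<Longrightarrow> p \<in> E \<Longrightarrow> \<phi> p \<in> verbal_ideal E X"
proof -
  have "\<phi> ` E \<subseteq> carrier (free_alg X)" if "\<phi> \<in> alg_hom (free_alg UNIV) (free_alg X)"
    for \<phi> :: "(word \<Rightarrow>\<^sub>0 'a) \<Rightarrow> (word \<Rightarrow>\<^sub>0 'a)"
    using alg_homD(1)[OF that] by (auto simp: free_alg_def)
  then show "alg_ideal (verbal_ideal E X) (free_alg X)"
    unfolding verbal_ideal_def
    by (intro alg_ideal_Inter linear_algebra_free_alg)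
      (auto simp: alg_ideal_carrier linear_algebra_free_alg intro!: exI[of _ "carrier (free_alg X)"])
  show "\<phi> \<in> alg_hom (free_alg UNIV) (free_alg X) \<Longrightarrow> p \<in> E \<Longrightarrow> \<phi> p \<in> verbal_ideal E X"
    by (auto simp: verbal_ideal_def)
qed

theorem linear_algebra_rel_free: "linear_algebra (rel_free E X)"
  unfolding rel_free_def by (intro alg_quot_facts linear_algebra_free_alg verbal_ideal)

theorem rel_free_satisfies:
  fixes E :: "(word \<Rightarrow>\<^sub>0 'k::field) set"
  assumes "p \<in> E"
  shows "satisfies (rel_free E X) p"
  unfolding satisfies_def
proof
  fix \<mu> assume \<mu>: "\<mu> \<in> alg_hom (free_alg UNIV) (rel_free E X)"
  note F = linear_algebra_free_alg[of X]
  note Q = alg_quot_facts[OF F verbal_ideal(1)[of E], folded rel_free_def]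
  let ?q = "\<lambda>x. verbal_ideal E X +>\<^bsub>free_alg X\<^esub> x"
  have "\<exists>x\<in>carrier (free_alg X). \<mu> (var i) = ?q x" for i
    using alg_homD(1)[OF \<mu> var_carrier[of i]] Q(3) by auto
  then obtain g where g: "\<And>i. g i \<in> carrier (free_alg X)" "\<And>i. \<mu> (var i) = ?q (g i)"
    by metis
  obtain \<phi> where \<phi>: "\<phi> \<in> alg_hom (free_alg UNIV) (free_alg X)" "\<And>i. \<phi> (var i) = g i"
    using free_alg_universal[OF F, of UNIV g] g(1) by auto
  have "\<mu> p = (?q \<circ> \<phi>) p"
    by (rule alg_hom_free_unique[OF linear_algebra_rel_free \<mu> alg_hom_comp[OF \<phi>(1) Q(2)]])
      (auto simp: g \<phi> free_alg_carrier)
  moreover have "\<phi> p \<in> verbal_ideal E X" "\<phi> p \<in> carrier (free_alg X)"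
    using verbal_ideal(2)[OF \<phi>(1) assms] alg_idealD(1)[OF F verbal_ideal(1)] by auto
  moreover have "?q \<zero>\<^bsub>free_alg X\<^esub> = \<zero>\<^bsub>rel_free E X\<^esub>"
    by (rule alg_hom_zero[OF F Q(1,2)])
  moreover have "?q (\<phi> p) = ?q \<zero>\<^bsub>free_alg X\<^esub>"
  proof -
    interpret linear_algebra "free_alg X :: ('k, word \<Rightarrow>\<^sub>0 'k) module" by (rule F)
    have "\<phi> p \<ominus>\<^bsub>free_alg X\<^esub> \<zero>\<^bsub>free_alg X\<^esub> = \<phi> p"
      "\<zero>\<^bsub>free_alg X\<^esub> \<in> carrier (free_alg X :: ('k, word \<Rightarrow>\<^sub>0 'k) module)"
      using \<open>\<phi> p \<in> carrier (free_alg X)\<close> by (metis M.minus_eq M.r_neg M.r_zero M.zero_closed M.a_inv_closed M.l_zero)+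
    then show ?thesis using Q(4)[of "\<phi> p" "\<zero>\<^bsub>free_alg X\<^esub>"] \<open>\<phi> p \<in> verbal_ideal E X\<close>
        \<open>\<phi> p \<in> carrier (free_alg X)\<close> by simp
  qed
  ultimately show "\<mu> p = \<zero>\<^bsub>rel_free E X\<^esub>" by simp
qed

theorem rel_free_universal:
  fixes E :: "(word \<Rightarrow>\<^sub>0 'k::field) set" and B :: "('k, 'b) module"
  assumes B: "linear_algebra B" and E: "\<And>p. p \<in> E \<Longrightarrow> satisfies B p"
    and f: "\<And>i. i \<in> X \<Longrightarrow> f i \<in> carrier B"
  shows "\<exists>\<mu>\<in>alg_hom (rel_free E X) B. (\<forall>i\<in>X. \<mu> (rel_gen E X i) = f i) \<and>
    (\<forall>\<nu>\<in>alg_hom (rel_free E X) B. (\<forall>i\<in>X. \<nu> (rel_gen E X i) = f i)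
       \<longrightarrow> (\<forall>x\<in>carrier (rel_free E X). \<nu> x = \<mu> x))"
proof -
  interpret B: linear_algebra B by fact
  note F = linear_algebra_free_alg[of X]
  interpret F: linear_algebra "free_alg X :: ('k, word \<Rightarrow>\<^sub>0 'k) module" by (rule F)
  note Q = alg_quot_facts[OF F verbal_ideal(1)[of E], folded rel_free_def]
  let ?q = "\<lambda>x. verbal_ideal E X +>\<^bsub>free_alg X\<^esub> x"
  obtain \<phi> where \<phi>: "\<phi> \<in> alg_hom (free_alg X) B" "\<And>i. i \<in> X \<Longrightarrow> \<phi> (var i) = f i"
    using free_alg_universal[OF B, of X f] f by auto
  have "verbal_ideal E X \<subseteq> {x \<in> carrier (free_alg X). \<phi> x = \<zero>\<^bsub>B\<^esub>}"
    unfolding verbal_ideal_def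
  proof (rule Inter_lower, safe)
    show "alg_ideal {x \<in> carrier (free_alg X). \<phi> x = \<zero>\<^bsub>B\<^esub>} (free_alg X)"
      by (rule alg_ideal_kernel[OF F B \<phi>(1)])
    fix \<psi> :: "(word \<Rightarrow>\<^sub>0 'k) \<Rightarrow> (word \<Rightarrow>\<^sub>0 'k)" and p
    assume \<psi>: "\<psi> \<in> alg_hom (free_alg UNIV) (free_alg X)" and p: "p \<in> E"
    show "\<psi> p \<in> carrier (free_alg X)"
      by (rule alg_homD(1)[OF \<psi>]) (simp add: free_alg_carrier)
    show "\<phi> (\<psi> p) = \<zero>\<^bsub>B\<^esub>"
      using E[OF p] alg_hom_comp[OF \<psi> \<phi>(1)] by (auto simp: satisfies_def)
  qed
  then have ker: "\<phi> x = \<zero>\<^bsub>B\<^esub>" if "x \<in> verbal_ideal E X" for x using that by auto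
  have fact: "\<phi> x = \<phi> y"
    if xy: "x \<in> carrier (free_alg X)" "y \<in> carrier (free_alg X)" "?q x = ?q y" for x y
  proof -
    have *: "x \<ominus>\<^bsub>free_alg X\<^esub> y \<in> verbal_ideal E X" using Q(4) xy by simp
    have "\<phi> x = \<phi> ((x \<ominus>\<^bsub>free_alg X\<^esub> y) \<oplus>\<^bsub>free_alg X\<^esub> y)"
      using xy by (simp only: F.M.minus_eq F.M.a_assoc F.M.a_inv_closed F.M.l_neg F.M.r_zero)
    also have "\<dots> = \<phi> y"
      using xy alg_homD(1,2)[OF \<phi>(1)] ker[OF *] F.M.minus_closed
      by (metis B.M.l_zero)
    finally show ?thesis .
  qed
  define \<mu> where "\<mu> U = \<phi> (SOME x. x \<in> carrier (free_alg X) \<and> U = ?q x)" for U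
  have \<mu>: "\<mu> (?q x) = \<phi> x" if "x \<in> carrier (free_alg X)" for x
    unfolding \<mu>_def using someI[of "\<lambda>y. y \<in> carrier (free_alg X) \<and> ?q x = ?q y" x] that
    by (intro fact) auto
  note qh = alg_homD(2,3,4)[OF Q(2), symmetric]
  have hom: "\<mu> \<in> alg_hom (rel_free E X) B"
    using alg_homD[OF \<phi>(1)] F.M.a_closed F.smult_closed F.prod_closed
    by (auto simp: alg_hom_def Q(3) qh \<mu> simp del: free_alg_simps)
  show ?thesis
  proof (intro bexI[OF _ hom] conjI ballI impI)
    fix i assume "i \<in> X"
    then show "\<mu> (rel_gen E X i) = f i" by (simp add: rel_gen_def \<mu> \<phi> var_carrier)
  next
    fix \<nu> x assume \<nu>: "\<nu> \<in> alg_hom (rel_free E X) B" "\<forall>i\<in>X. \<nu> (rel_gen E X i) = f i"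
      and "x \<in> carrier (rel_free E X)"
    then obtain p where p: "p \<in> carrier (free_alg X)" "x = ?q p" by (auto simp: Q(3))
    have "(\<nu> \<circ> ?q) p = \<phi> p"
      by (rule alg_hom_free_unique[OF B alg_hom_comp[OF Q(2) \<nu>(1)] \<phi>(1) _ p(1)])
        (use \<nu>(2) \<phi>(2) in \<open>auto simp: rel_gen_def\<close>)
    then show "\<nu> x = \<mu> x" using p \<mu> by simp
  qed
qed

end

(* Geometrically equivalent algebras satisfy the same identities: take T empty.  The algebra H
   satisfies (x1 x1) x2 = 0, whereas (g * g) * g = (a + b) b g (g g) for the new product, where
   g is a free generator.  The element g (g g) is not 0: map g to e in the algebra with basis
   e, z and products e e = e z = z, z e = z z = 0, which lies in the subvariety. *)

theory Submission
  imports Defs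
begin

text \<open>Values off the carrier are unconstrained, so the restriction of a homomorphism to a
  smaller free algebra is the same function.\<close>

lemma alg_hom_free_mono:
  assumes "X \<subseteq> Y"
  shows "alg_hom (free_alg Y) A \<subseteq> alg_hom (free_alg X) A"
  using assms by (fastforce simp: alg_hom_def free_alg_carrier Pi_iff)

lemma satisfies_alg_hom_free:
  assumes A: "linear_algebra A" and sat: "satisfies A p"
    and p: "p \<in> carrier (free_alg X)" and \<mu>: "\<mu> \<in> alg_hom (free_alg X) A"
  shows "\<mu> p = \<zero>\<^bsub>A\<^esub>"
proof -
  interpret linear_algebra A by fact
  \<comment> \<open>\<open>satisfies\<close> speaks of homomorphisms from the free algebra on all
    symbols, so \<open>\<mu>\<close> is extended by sending the symbols outside \<open>X\<close> to
    zero.\<close>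
  let ?f = "\<lambda>i. if i \<in> X then \<mu> (var i) else \<zero>\<^bsub>A\<^esub>"
  have "?f i \<in> carrier A" for i
    using alg_homD(1)[OF \<mu> var_carrier] by simp
  then obtain \<nu> where \<nu>: "\<nu> \<in> alg_hom (free_alg UNIV) A" "\<And>i. \<nu> (var i) = ?f i"
    using free_alg_universal[OF A, of UNIV ?f] by auto
  have "\<mu> p = \<nu> p"
    using alg_hom_free_mono[of X UNIV A] \<nu>
    by (intro alg_hom_free_unique[OF A \<mu> _ _ p]) auto
  with sat \<nu>(1) show ?thesis by (simp add: satisfies_def)
qed

text \<open>With no equations imposed every homomorphism is a solution, so the closure of the empty
  set consists of the pairs that all homomorphisms identify; an identity \<open>p\<close> puts
  \<open>(p, 0)\<close> there.\<close>

lemma geometrically_equivalent_satisfies: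
  fixes A :: "('k::field, 'a) module" and B :: "('k, 'b) module"
  assumes A: "linear_algebra A" and B: "linear_algebra B"
    and equiv: "geometrically_equivalent A B" and sat: "satisfies A p"
  shows "satisfies B p"
  unfolding satisfies_def
proof
  fix \<mu> assume \<mu>: "\<mu> \<in> alg_hom (free_alg UNIV) B"
  \<comment> \<open>Geometric equivalence tests finite sets of symbols only; those occurring in
    \<open>p\<close> suffice.\<close>
  define X where "X = (\<Union>t\<in>Poly_Mapping.keys p. symbols t)"
  have "finite (symbols t)" for t
    by (induction t) auto
  then have X: "finite X"
    by (simp add: X_def)
  have p: "p \<in> carrier (free_alg X)" "0 \<in> carrier (free_alg X)"
    by (auto simp: X_def free_alg_def)
  have zero: "\<nu> 0 = \<zero>\<^bsub>C\<^esub>" if "linear_algebra C" "\<nu> \<in> alg_hom (free_alg X) C"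
    for C :: "('k, 'c) module" and \<nu>
    using alg_hom_zero[OF linear_algebra_free_alg that] by simp
  have "(p, 0) \<in> H_closure A X {}"
    using p satisfies_alg_hom_free[OF A sat p(1)] zero[OF A]
    by (auto simp: H_closure_def solutions_def ker_cong_def)
  then have "(p, 0) \<in> H_closure B X {}"
    using equiv X by (simp add: geometrically_equivalent_def)
  moreover have "\<mu> \<in> alg_hom (free_alg X) B"
    using \<mu> alg_hom_free_mono[of X UNIV B] by auto
  ultimately show "\<mu> p = \<zero>\<^bsub>B\<^esub>"
    using zero[OF B] by (auto simp: H_closure_def solutions_def ker_cong_def)
qed

lemma satisfies_sq_mult_iff:
  fixes A :: "('k::field, 'a) module"
  assumes A: "linear_algebra A"
  shows "satisfies A (poly_prod (poly_prod (var 1) (var 1)) (var 2)) \<longleftrightarrow>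
    (\<forall>x\<in>carrier A. \<forall>y\<in>carrier A. (x \<otimes>\<^bsub>A\<^esub> x) \<otimes>\<^bsub>A\<^esub> y = \<zero>\<^bsub>A\<^esub>)"
proof -
  have eval: "\<mu> (poly_prod (poly_prod (var 1) (var 1)) (var 2)) =
      (\<mu> (var 1) \<otimes>\<^bsub>A\<^esub> \<mu> (var 1)) \<otimes>\<^bsub>A\<^esub> \<mu> (var 2)" if "\<mu> \<in> alg_hom (free_alg UNIV) A" for \<mu>
    using alg_homD(4)[OF that] by (simp add: free_alg_carrier)
  show ?thesis
  proof (intro iffI ballI)
    fix x y assume sat: "satisfies A (poly_prod (poly_prod (var 1) (var 1)) (var 2))"
      and xy: "x \<in> carrier A" "y \<in> carrier A"
    let ?f = "\<lambda>i::nat. if i = 1 then x else y"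
    have "?f i \<in> carrier A" for i
      using xy by simp
    then obtain \<mu> where \<mu>: "\<mu> \<in> alg_hom (free_alg UNIV) A" and f: "\<And>i. \<mu> (var i) = ?f i"
      using free_alg_universal[OF A, of UNIV ?f] by blast
    have "\<mu> (poly_prod (poly_prod (var 1) (var 1)) (var 2)) = \<zero>\<^bsub>A\<^esub>"
      using sat \<mu> unfolding satisfies_def by (rule bspec)
    then show "(x \<otimes>\<^bsub>A\<^esub> x) \<otimes>\<^bsub>A\<^esub> y = \<zero>\<^bsub>A\<^esub>"
      unfolding eval[OF \<mu>] f by simp
  next
    assume zero: "\<forall>x\<in>carrier A. \<forall>y\<in>carrier A. (x \<otimes>\<^bsub>A\<^esub> x) \<otimes>\<^bsub>A\<^esub> y = \<zero>\<^bsub>A\<^esub>"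
    show "satisfies A (poly_prod (poly_prod (var 1) (var 1)) (var 2))"
      unfolding satisfies_def
    proof
      fix \<mu> assume \<mu>: "\<mu> \<in> alg_hom (free_alg UNIV) A"
      then have "\<mu> (var i) \<in> carrier A" for i
        using alg_homD(1)[OF \<mu> var_carrier] by simp
      with zero show "\<mu> (poly_prod (poly_prod (var 1) (var 1)) (var 2)) = \<zero>\<^bsub>A\<^esub>"
        unfolding eval[OF \<mu>] by blast
    qed
  qed
qed

text \<open>The new product is a verbal operation: it is composed of addition, scaling and the old
  product, all of which \<open>\<mu>\<close> preserves.\<close>

lemma star_alg_hom:
  assumes A: "linear_algebra A" and \<mu>: "\<mu> \<in> alg_hom A B"
  shows "\<mu> \<in> alg_hom (star_alg a b A) (star_alg a b B)"
proof -
  interpret linear_algebra A by fact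
  show ?thesis
    using \<mu> smult_closed prod_closed by (auto simp: alg_hom_def star_alg_def Pi_iff)
qed

text \<open>The pair \<open>(p, q)\<close> stands for p e + q z, so that (p e + q z)(r e + s z) = p
  (r + s) z.\<close>

definition sq_annihilating_alg :: "('k::field, 'k \<times> 'k) module" where
  "sq_annihilating_alg = \<lparr>carrier = UNIV, mult = (\<lambda>(p, q) (r, s). (0, p * (r + s))),
     one = undefined, zero = (0, 0), add = (\<lambda>(p, q) (r, s). (p + r, q + s)),
     smult = (\<lambda>c (p, q). (c * p, c * q))\<rparr>"

lemma linear_algebra_sq_annihilating_alg: "linear_algebra sq_annihilating_alg"
proof (rule linear_algebraI)
  show "abelian_group (sq_annihilating_alg :: ('k::field, 'k \<times> 'k) module)"
  proof (rule abelian_groupI)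
    fix x :: "'k \<times> 'k"
    show "\<exists>y\<in>carrier sq_annihilating_alg.
        y \<oplus>\<^bsub>sq_annihilating_alg\<^esub> x = \<zero>\<^bsub>sq_annihilating_alg\<^esub>"
      by (intro bexI[of _ "(- fst x, - snd x)"])
        (auto simp: sq_annihilating_alg_def split: prod.splits)
  qed (auto simp: sq_annihilating_alg_def)
qed (auto simp: sq_annihilating_alg_def algebra_simps)

theorem proposition5p1:
  fixes a b :: rat
  assumes "a \<noteq> b" and "a \<noteq> - b" and "b \<noteq> 0"
  shows "\<not> geometrically_equivalent H_alg (star_alg a b H_alg)"
proof
  let ?p = "poly_prod (poly_prod (var 1) (var 1)) (var 2) :: word \<Rightarrow>\<^sub>0 rat"
  let ?B = "sq_annihilating_alg :: (rat, rat \<times> rat) module"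
  let ?S = "star_alg a b H_alg"
  have H: "linear_algebra H_alg"
    unfolding H_alg_def by (rule linear_algebra_rel_free)
  note S = linear_algebra_star_alg[OF H, of a b]
  have B: "linear_algebra ?B"
    by (rule linear_algebra_sq_annihilating_alg)
  have "satisfies H_alg ?p"
    unfolding H_alg_def by (rule rel_free_satisfies) simp
  moreover assume "geometrically_equivalent H_alg ?S"
  ultimately have "satisfies ?S ?p"
    using geometrically_equivalent_satisfies[OF H S] by blast
  then have zero: "(x \<otimes>\<^bsub>?S\<^esub> x) \<otimes>\<^bsub>?S\<^esub> x = \<zero>\<^bsub>?S\<^esub>" if "x \<in> carrier ?S" for x
    using satisfies_sq_mult_iff[OF S] that by blast
  define g :: "(word \<Rightarrow>\<^sub>0 rat) set" where "g = rel_gen {?p} {1, 2} 1"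
  \<comment> \<open>Every product is a multiple of z, and z annihilates everything to its
    right.\<close>
  have "satisfies ?B ?p"
    unfolding satisfies_sq_mult_iff[OF B] by (auto simp: sq_annihilating_alg_def)
  \<comment> \<open>Both generators are sent to e.\<close>
  then obtain \<mu> where \<mu>: "\<mu> \<in> alg_hom H_alg ?B" "\<mu> g = (1, 0)"
    using rel_free_universal[OF B, of "{?p}" "{1, 2}" "\<lambda>_. (1, 0)"]
    by (auto simp: H_alg_def g_def sq_annihilating_alg_def)
  have "g \<in> carrier H_alg"
    using alg_quot_facts(3)[OF linear_algebra_free_alg verbal_ideal(1), of "{1, 2}" "{?p}"]
    by (auto simp: H_alg_def rel_free_def g_def rel_gen_def var_carrier)
  then have g: "g \<in> carrier ?S"
    by (simp add: star_alg_def)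
  interpret S: linear_algebra ?S by (rule S)
  \<comment> \<open>The new products of \<open>g\<close> can now be computed on e in the
    two-dimensional algebra.\<close>
  note h = star_alg_hom[OF H \<mu>(1), of a b]
  \<comment> \<open>The new square of e is (a + b) z. In its new product with e on the right, the
    term with factor a vanishes since z e = 0, and the term with factor b gives b (a + b) z since e
    z = z. This is nonzero because \<open>b \<noteq> 0\<close> and
    \<open>a \<noteq> - b\<close>.\<close>
  have "\<mu> ((g \<otimes>\<^bsub>?S\<^esub> g) \<otimes>\<^bsub>?S\<^esub> g) = (0, b * (a + b))"
    using g alg_homD(4)[OF h] S.prod_closed \<mu>(2)
    by (simp add: star_alg_def sq_annihilating_alg_def)
  moreover have "\<mu> \<zero>\<^bsub>?S\<^esub> = (0, 0)"
    using alg_hom_zero[OF S linear_algebra_star_alg[OF B] h]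
    by (simp add: star_alg_def sq_annihilating_alg_def)
  ultimately show False
    using zero[OF g] assms by (auto simp: add_eq_0_iff)
qed

end
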